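(* Let $q\ge 32$ be a prime power with $q\not\equiv 3\pmod 4$, let $\xi$ be a primitive element of $F_q$, and let $\gamma=-1$ if $q$ is odd and $\gamma=1$ if $q$ is even. Let $G$ be an integer with $\lfloor (q-1)/3\rfloor\le G\le\lceil (q-3)/2\rceil$, let $\mathcal{D}_G=\{(1,\xi^d,\xi^{2d}): d=0,1,\dots,G\}$, $Z=(1,0,\gamma)$, $B_G=(1,0,\gamma\xi^{2G})$. Then $\mathcal{W}_G=\mathcal{D}_G\cup\{Z,B_G\}$ is a $(G+3)$-arc in $PG(2,q)$.
   Context: Points of $PG(2,q)$ are in homogeneous coordinates $(x_0,x_1,x_2)$. An arc is a set of points no three collinear. *)

theory Defs
  imports "HOL-Analysis.Analysis" "HOL-Number_Theory.Prime_Powers"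
begin

text \<open>
  \<open>PG(2,q)\<close> over the field \<open>'a\<close> of order \<open>q\<close>: points and lines are the subspaces of
  \<open>'a ^ 3\<close> of dimension 1 and 2, and incidence is inclusion.
\<close>

definition pg_points :: "('a::field ^ 3) set set" where
  "pg_points = {P. vec.subspace P \<and> vec.dim P = 1}"

definition pg_lines :: "('a::field ^ 3) set set" where
  "pg_lines = {L. vec.subspace L \<and> vec.dim L = 2}"

definition pg_collinear :: "('a::field ^ 3) set set \<Rightarrow> bool" where
  "pg_collinear S \<longleftrightarrow> (\<exists>L\<in>pg_lines. \<forall>P\<in>S. P \<subseteq> L)"

definition pg_arc :: "('a::field ^ 3) set set \<Rightarrow> bool" where
  "pg_arc S \<longleftrightarrow> S \<subseteq> pg_points \<and>
     (\<forall>P\<in>S. \<forall>Q\<in>S. \<forall>R\<in>S. P \<noteq> Q \<and> P \<noteq> R \<and> Q \<noteq> R \<longrightarrow> \<not> pg_collinear {P, Q, R})"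

definition pg_n_arc :: "nat \<Rightarrow> ('a::field ^ 3) set set \<Rightarrow> bool" where
  "pg_n_arc n S \<longleftrightarrow> pg_arc S \<and> finite S \<and> card S = n"

text \<open>The point with homogeneous coordinates \<open>(x\<^sub>0, x\<^sub>1, x\<^sub>2)\<close>, which must not all vanish.\<close>

definition pg_point :: "'a::field \<Rightarrow> 'a \<Rightarrow> 'a \<Rightarrow> ('a ^ 3) set" where
  "pg_point x0 x1 x2 = vec.span {vector [x0, x1, x2]}"

definition primitive_element :: "'a::field \<Rightarrow> bool" where
  "primitive_element \<xi> \<longleftrightarrow> range (\<lambda>k::nat. \<xi> ^ k) = UNIV - {0}"

definition arc_D :: "'a::field \<Rightarrow> nat \<Rightarrow> ('a ^ 3) set set" where
  "arc_D \<xi> G = {pg_point 1 (\<xi> ^ d) (\<xi> ^ (2 * d)) | d. d \<le> G}"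

definition point_Z :: "'a::field \<Rightarrow> ('a ^ 3) set" where
  "point_Z \<gamma> = pg_point 1 0 \<gamma>"

definition point_B :: "'a::field \<Rightarrow> 'a \<Rightarrow> nat \<Rightarrow> ('a ^ 3) set" where
  "point_B \<gamma> \<xi> G = pg_point 1 0 (\<gamma> * \<xi> ^ (2 * G))"

definition arc_W :: "'a::field \<Rightarrow> 'a \<Rightarrow> nat \<Rightarrow> ('a ^ 3) set set" where
  "arc_W \<gamma> \<xi> G = arc_D \<xi> G \<union> {point_Z \<gamma>, point_B \<gamma> \<xi> G}"

end

theory Submission
  imports Defs
begin

text \<open>
  The points of \<open>arc_D\<close> lie on the conic \<open>x\<^sub>1\<^sup>2 = x\<^sub>0 x\<^sub>2\<close>, so no three of them are collinear. The points
  of the conic with parameters \<open>t \<noteq> u\<close> are collinear with \<open>(1, 0, c)\<close> iff \<open>t u = - c\<close>. As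
  \<open>- \<gamma> = 1\<close> in the field, a collinearity with \<open>Z\<close> means \<open>\<xi> ^ (i + j) = 1\<close> and one with
  \<open>B\<^sub>G\<close> means \<open>\<xi> ^ (i + j) = \<xi> ^ (2 * G)\<close>, where \<open>0 \<le> i < j \<le> G\<close>. Both are impossible, since
  \<open>0 < i + j < 2 * G < q - 1\<close>. Finally the line joining \<open>Z\<close> and \<open>B\<^sub>G\<close> is \<open>x\<^sub>1 = 0\<close>, which misses
  the points with nonzero parameter.
\<close>

lemma vector_in_pg_point: "vector [x, y, z] \<in> pg_point x y z"
  by (simp add: pg_point_def vec.span_base)

lemma pg_point_in_pg_points: "pg_point 1 a b \<in> pg_points"
proof -
  have "(vector [1, a, b] :: 'a ^ 3) \<noteq> 0"
    by (metis vector_3(1) zero_index zero_neq_one)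
  then show ?thesis
    by (simp add: pg_points_def pg_point_def vec.dim_span vec.dim_singleton)
qed

lemma pg_point_1_eq_iff: "pg_point 1 a b = pg_point 1 c d \<longleftrightarrow> a = c \<and> b = d"
proof
  assume "pg_point 1 a b = pg_point 1 c d"
  then have "vector [1, a, b] \<in> vec.span {vector [1, c, d] :: 'a ^ 3}"
    using vector_in_pg_point pg_point_def by metis
  then obtain k where k: "vector [1, a, b] = k *s (vector [1, c, d] :: 'a ^ 3)"
    by (auto simp: vec.span_singleton)
  then have "(vector [1, a, b] :: 'a ^ 3) $ i = k * (vector [1, c, d] :: 'a ^ 3) $ i" for i
    by simp
  \<comment> \<open>The leading coordinates, both 1, force \<open>k = 1\<close>.\<close>
  from this[of 1] this[of 2] this[of 3] show "a = c \<and> b = d"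
    by simp
qed simp

text \<open>A nonzero determinant would make the three coordinate vectors span the whole space,
  which no plane through the origin contains. The equation is this determinant set to 0, with the
  first row subtracted from the other two.\<close>

lemma pg_collinear_imp_det_eq_0:
  assumes "pg_collinear {pg_point 1 a1 b1, pg_point 1 a2 b2, pg_point 1 a3 b3}"
  shows "(a2 - a1) * (b3 - b1) = (a3 - a1) * (b2 - b1)"
proof (rule ccontr)
  assume neq: "\<not> ?thesis"
  define A :: "'a ^ 3 ^ 3"
    where "A = vector [vector [1, a1, b1], vector [1, a2, b2], vector [1, a3, b3]]"
  have "det A = (a2 - a1) * (b3 - b1) - (a3 - a1) * (b2 - b1)"
    by (simp add: A_def det_3 algebra_simps)
  with neq have "invertible A"
    by (simp add: invertible_det_nz)
  then have span: "vec.span (rows A) = UNIV"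
    by (simp add: invertible_left_inverse matrix_left_invertible_span_rows_gen)
  obtain L where L: "vec.subspace L" "vec.dim L = 2"
      "pg_point 1 a1 b1 \<subseteq> L" "pg_point 1 a2 b2 \<subseteq> L" "pg_point 1 a3 b3 \<subseteq> L"
    using assms by (auto simp: pg_collinear_def pg_lines_def)
  have "row i A \<in> L" for i
    using exhaust_3[of i] L(3-5) vector_in_pg_point[of 1 a1 b1] vector_in_pg_point[of 1 a2 b2]
      vector_in_pg_point[of 1 a3 b3]
    by (auto simp: row_def A_def vec_lambda_eta)
  then have "rows A \<subseteq> L"
    by (auto simp: rows_def)
  then have "L = UNIV"
    using span L(1) vec.span_minimal by blast
  with L(2) show False
    by (simp add: vec.dim_UNIV card_cart_basis)
qed

text \<open>Lets an arc grow point by point: collinearity ignores order, so only triples with the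
  new point in front need checking.\<close>

lemma pg_arc_insert:
  assumes "pg_arc S" and "P \<in> pg_points"
    and "\<And>Q R. Q \<in> S \<Longrightarrow> R \<in> S \<Longrightarrow> Q \<noteq> R \<Longrightarrow> P \<noteq> Q \<Longrightarrow> P \<noteq> R \<Longrightarrow> \<not> pg_collinear {P, Q, R}"
  shows "pg_arc (insert P S)"
proof -
  have perm: "\<not> pg_collinear {Q, P, R}" "\<not> pg_collinear {Q, R, P}"
    if "Q \<in> S" "R \<in> S" "Q \<noteq> R" "P \<noteq> Q" "P \<noteq> R" for Q R
    using assms(3)[OF that] by (simp_all add: insert_commute)
  have "\<not> pg_collinear {X, Y, W}"
    if *: "X \<in> insert P S" "Y \<in> insert P S" "W \<in> insert P S" "X \<noteq> Y" "X \<noteq> W" "Y \<noteq> W" for X Y W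
  proof -
    consider "X = P" "Y \<in> S" "W \<in> S" | "Y = P" "X \<in> S" "W \<in> S" | "W = P" "X \<in> S" "Y \<in> S"
      | "X \<in> S" "Y \<in> S" "W \<in> S"
      using * by (metis insertE)
    then show ?thesis
      using * assms(1,3) perm unfolding pg_arc_def by cases metis+
  qed
  with assms(1,2) show ?thesis
    unfolding pg_arc_def by simp
qed

lemma pg_collinear_conic_points:
  assumes "pg_collinear {pg_point 1 t (t\<^sup>2), pg_point 1 u (u\<^sup>2), pg_point 1 v (v\<^sup>2)}"
  shows "t = u \<or> t = v \<or> u = v"
proof -
  \<comment> \<open>The determinant is of Vandermonde type.\<close>
  have "(u - t) * (v - t) * (v - u) = 0"
    using pg_collinear_imp_det_eq_0[OF assms] by (simp add: power2_eq_square algebra_simps)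
  then show ?thesis
    by auto
qed

lemma pg_collinear_axis_conic_points:
  assumes "pg_collinear {pg_point 1 0 c, pg_point 1 t (t\<^sup>2), pg_point 1 u (u\<^sup>2)}"
  shows "t = u \<or> t * u = - c"
proof -
  have "(u - t) * (t * u + c) = 0"
    using pg_collinear_imp_det_eq_0[OF assms] by (simp add: power2_eq_square algebra_simps)
  then show ?thesis
    by (auto simp: eq_neg_iff_add_eq_0)
qed

lemma pg_collinear_axis_points:
  assumes "pg_collinear {pg_point 1 0 c, pg_point 1 0 d, pg_point 1 t e}"
  shows "t = 0 \<or> c = d"
  using pg_collinear_imp_det_eq_0[OF assms] by auto

lemma primitive_element_nonzero:
  assumes "primitive_element \<xi>"
  shows "\<xi> \<noteq> 0"
  using assms rangeI[of "\<lambda>k. \<xi> ^ k" 1] by (simp add: primitive_element_def)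

text \<open>If \<open>\<xi> ^ n = 1\<close>, powers depend only on the exponent mod
  \<open>n\<close>, so at most \<open>n\<close> values must cover all nonzero elements.\<close>

lemma primitive_element_power_eq_1_le:
  fixes \<xi> :: "'a::{field,finite}"
  assumes "primitive_element \<xi>" and "\<xi> ^ n = 1" and "n > 0"
  shows "CARD('a) - 1 \<le> n"
proof -
  have "\<xi> ^ k = \<xi> ^ (k mod n)" for k
    using assms(2) by (metis div_mult_mod_eq mult.commute mult_1 power_add power_mult power_one)
  then have "range (\<lambda>k. \<xi> ^ k) \<subseteq> (\<lambda>k. \<xi> ^ k) ` {..<n}"
    using assms(3) by (metis image_eqI image_subsetI lessThan_iff mod_less_divisor)
  then have "card (UNIV - {0 :: 'a}) \<le> card {..<n}"
    using assms(1) unfolding primitive_element_def by (metis finite_lessThan surj_card_le)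
  then show ?thesis
    by (simp add: card_Diff_singleton)
qed

lemma primitive_element_power_neq:
  fixes \<xi> :: "'a::{field,finite}"
  assumes "primitive_element \<xi>" and "i < j" and "j < CARD('a) - 1"
  shows "\<xi> ^ i \<noteq> \<xi> ^ j"
proof
  assume "\<xi> ^ i = \<xi> ^ j"
  also have "\<dots> = \<xi> ^ i * \<xi> ^ (j - i)"
    using assms(2) by (simp flip: power_add)
  finally have "\<xi> ^ (j - i) = 1"
    using primitive_element_nonzero[OF assms(1)] by simp
  from primitive_element_power_eq_1_le[OF assms(1) this] show False
    using assms(2,3) by simp
qed

lemma primitive_element_inj_on_power:
  fixes \<xi> :: "'a::{field,finite}"
  assumes "primitive_element \<xi>"
  shows "inj_on (\<lambda>k. \<xi> ^ k) {..<CARD('a) - 1}"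
  using primitive_element_power_neq[OF assms]
  by (intro linorder_inj_onI) auto

text \<open>Negation permutes the nonzero elements, so their product absorbs one factor -1 for each
  of them; their number is odd.\<close>

lemma minus_1_eq_1_if_even_CARD:
  assumes "even CARD('a::{field,finite})"
  shows "(- 1 :: 'a) = 1"
proof -
  let ?U = "UNIV - {0 :: 'a}"
  have "(\<Prod>x\<in>?U. x) = (\<Prod>x\<in>?U. - x)"
    by (rule prod.reindex_bij_witness[of _ uminus uminus]) auto
  also have "\<dots> = (- 1) ^ card ?U * (\<Prod>x\<in>?U. x)"
    by (simp only: prod_constant[symmetric] prod.distrib[symmetric] mult_minus1)
  finally have "(- 1 :: 'a) ^ card ?U = 1"
    by simp
  moreover have "odd (card ?U)"
    using assms by (simp add: card_Diff_singleton)
  ultimately show ?thesis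
    by simp
qed

lemma arc_D_eq_image: "arc_D \<xi> G = (\<lambda>d. pg_point 1 (\<xi> ^ d) ((\<xi> ^ d)\<^sup>2)) ` {..G}"
  by (auto simp: arc_D_def power_mult[symmetric] mult.commute)

theorem theorem14:
  fixes q G :: nat and \<xi> \<gamma> :: "'a::{field,finite}"
  assumes "primepow q" and "CARD('a) = q"
    and "q \<ge> 32" and "q mod 4 \<noteq> 3"
    and "primitive_element \<xi>"
    and "\<gamma> = (if odd q then - 1 else 1)"
    and "\<lfloor>(real q - 1) / 3\<rfloor> \<le> int G" and "int G \<le> \<lceil>(real q - 3) / 2\<rceil>"
  shows "pg_n_arc (G + 3) (arc_W \<gamma> \<xi> G)"
proof -
  \<comment> \<open>A ceiling exceeds its argument by less than 1. The strict inequality yields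
    \<open>2 * G < q - 1\<close>, so the exponents 0 to \<open>2 * G\<close> give distinct
    powers.\<close>
  have "real G < (real q - 3) / 2 + 1"
    using assms(8) ceiling_correct[of "(real q - 3) / 2"]
    by (metis diff_less_eq of_int_le_iff of_int_of_nat_eq order_le_less_trans)
  then have "real (2 * G + 1) < real q"
    by (simp add: field_simps)
  then have bound: "2 * G < CARD('a) - 1"
    using assms(2) by (simp only: of_nat_less_iff less_diff_conv)
  \<comment> \<open>A positive \<open>G\<close> is what separates \<open>Z\<close> from
    \<open>B\<close>.\<close>
  have "1 \<le> \<lfloor>(real q - 1) / 3\<rfloor>"
    using assms(3) by (simp add: le_floor_iff)
  then have "G > 0"
    using assms(7) by linarith
  have \<gamma>: "\<gamma> = - 1"
    using assms(2,6) minus_1_eq_1_if_even_CARD[where 'a = 'a] by simp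
  note neq = primitive_element_power_neq[OF assms(5)]
  have nz: "\<xi> ^ d \<noteq> 0" for d
    using primitive_element_nonzero[OF assms(5)] by simp
  have Z_neq_B: "\<xi> ^ (2 * G) \<noteq> 1"
    using neq[of 0 "2 * G"] bound \<open>G > 0\<close> by simp
  have prod_neq: "\<xi> ^ i * \<xi> ^ j \<noteq> 1 \<and> \<xi> ^ i * \<xi> ^ j \<noteq> \<xi> ^ (2 * G)"
    if "i \<le> G" "j \<le> G" "i \<noteq> j" for i j
  proof -
    \<comment> \<open>The extreme sums 0 and \<open>2 * G\<close> would force
      \<open>i = j\<close>.\<close>
    have "0 < i + j" "i + j < 2 * G"
      using that by arith+
    then show ?thesis
      using neq[of 0 "i + j"] neq[of "i + j" "2 * G"] bound by (auto simp: power_add)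
  qed
  have inj: "inj_on (\<lambda>d. pg_point 1 (\<xi> ^ d) ((\<xi> ^ d)\<^sup>2)) {..G}"
    using primitive_element_inj_on_power[OF assms(5)] bound
    by (auto simp: inj_on_def pg_point_1_eq_iff)
  have conic: "\<not> pg_collinear {point_Z \<gamma>, Q, R} \<and> \<not> pg_collinear {point_B \<gamma> \<xi> G, Q, R}"
    if "Q \<in> arc_D \<xi> G" "R \<in> arc_D \<xi> G" "Q \<noteq> R" for Q R
  proof -
    obtain i j where ij: "i \<le> G" "j \<le> G" "i \<noteq> j"
      and Q: "Q = pg_point 1 (\<xi> ^ i) ((\<xi> ^ i)\<^sup>2)" and R: "R = pg_point 1 (\<xi> ^ j) ((\<xi> ^ j)\<^sup>2)"
      using \<open>Q \<in> _\<close> \<open>R \<in> _\<close> \<open>Q \<noteq> R\<close> unfolding arc_D_eq_image by blast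
    have "\<xi> ^ i \<noteq> \<xi> ^ j"
      using \<open>Q \<noteq> R\<close> Q R by auto
    then show ?thesis
      \<comment> \<open>The open argument is the last coordinate: -1 for \<open>Z\<close>,
        \<open>- (\<xi> ^ (2 * G))\<close> for \<open>B\<close>.\<close>
      using prod_neq[OF ij] pg_collinear_axis_conic_points[of _ "\<xi> ^ i" "\<xi> ^ j"]
      unfolding Q R point_Z_def point_B_def \<gamma> by fastforce
  qed
  have axis: "\<not> pg_collinear {point_Z \<gamma>, point_B \<gamma> \<xi> G, R}"
      "\<not> pg_collinear {point_Z \<gamma>, R, point_B \<gamma> \<xi> G}" if "R \<in> arc_D \<xi> G" for R
  proof -
    obtain d where R: "R = pg_point 1 (\<xi> ^ d) ((\<xi> ^ d)\<^sup>2)"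
      using \<open>R \<in> _\<close> unfolding arc_D_eq_image by blast
    show "\<not> pg_collinear {point_Z \<gamma>, point_B \<gamma> \<xi> G, R}"
      using pg_collinear_axis_points nz Z_neq_B
      unfolding R point_Z_def point_B_def \<gamma> by fastforce
    then show "\<not> pg_collinear {point_Z \<gamma>, R, point_B \<gamma> \<xi> G}"
      by (simp add: insert_commute)
  qed
  have "pg_arc (arc_D \<xi> G)"
    unfolding pg_arc_def arc_D_eq_image
    by (auto simp: pg_point_in_pg_points dest!: pg_collinear_conic_points)
  \<comment> \<open>With \<open>B\<close> added first, triples containing both axis points arise
    only when \<open>Z\<close> is added.\<close>
  then have "pg_arc (insert (point_B \<gamma> \<xi> G) (arc_D \<xi> G))"
    by (rule pg_arc_insert) (use conic in \<open>simp_all add: point_B_def pg_point_in_pg_points\<close>)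
  then have "pg_arc (insert (point_Z \<gamma>) (insert (point_B \<gamma> \<xi> G) (arc_D \<xi> G)))"
  proof (rule pg_arc_insert)
    show "point_Z \<gamma> \<in> pg_points"
      by (simp add: point_Z_def pg_point_in_pg_points)
    show "\<not> pg_collinear {point_Z \<gamma>, Q, R}"
      if "Q \<in> insert (point_B \<gamma> \<xi> G) (arc_D \<xi> G)" "R \<in> insert (point_B \<gamma> \<xi> G) (arc_D \<xi> G)"
        "Q \<noteq> R" for Q R
      using that conic axis by (metis insertE)
  qed
  moreover have "arc_W \<gamma> \<xi> G = insert (point_Z \<gamma>) (insert (point_B \<gamma> \<xi> G) (arc_D \<xi> G))"
    by (auto simp: arc_W_def)
  moreover have "finite (arc_D \<xi> G)" "card (arc_D \<xi> G) = G + 1"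
    using inj by (simp_all add: arc_D_eq_image card_image)
  \<comment> \<open>For the count: the middle coordinate is zero at \<open>Z\<close> and
    \<open>B\<close> but nonzero on the conic points, and the last coordinate tells \<open>Z\<close>
    from \<open>B\<close>.\<close>
  moreover have "point_B \<gamma> \<xi> G \<notin> arc_D \<xi> G" "point_Z \<gamma> \<notin> insert (point_B \<gamma> \<xi> G) (arc_D \<xi> G)"
    using nz Z_neq_B \<gamma> by (auto simp: point_B_def point_Z_def arc_D_def pg_point_1_eq_iff)
  ultimately show ?thesis
    by (simp add: pg_n_arc_def)
qed

end
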